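(* Let $r\ge1$ be an integer, let $\omega\in\mathbb{R}$ and let $S:\mathbb{R}^{r+1}\to\mathbb{R}$ be a local potential satisfying conditions A, B and C. Assume that $\mathcal{M}_\omega$ (for $S$) is not a foliation. Then there exist a $\delta>0$ and a $K>0$ such that for all local potentials $S^\delta:\mathbb{R}^{r+1}\to\mathbb{R}$ that satisfy conditions A, B and C and the estimates $\|S^\delta-S\|_{C^0(\mathbb{X}_K)}<\delta$ and $\|S^\delta-S\|_{C^1(\mathbb{X}_K)}\le1$, also $\mathcal{M}^\delta_\omega$ (the corresponding set for $S^\delta$) is not a foliation.
   Context: Conditions on $S:\mathbb{R}^{r+1}\to\mathbb{R}$, written as $S(x_0,\dots,x_r)$: A (periodicity): $S(x_0+1,\dots,x_r+1)=S(x_0,\dots,x_r)$ for all arguments. B (monotonicity): $S$ is twice continuously differentiable, $\partial_i\partial_k S\le 0$ everywhere for all $i\ne k$, and $\partial_0\partial_1 S<0$ everywhere. C (coercivity): $S$ is bounded from below and there is $k\in\{0,\dots,r-1\}$ such that $S(x_0,\dots,x_r)\to\infty$ as $|x_{k+1}-x_k|\to\infty$. For integers $i_0\le i_1$ and $x:\mathbb{Z}\to\mathbb{R}$ let $W_{[i_0,i_1]}(x)=\sum_{j=i_0}^{i_1}S(x_j,\dots,x_{j+r})$. A sequence $x$ is a global minimizer (for $S$) if $W_{[i_0,i_1]}(x)\le W_{[i_0,i_1]}(x+v)$ for all finite intervals $[i_0,i_1]\subset\mathbb{Z}$ and all $v:\mathbb{Z}\to\mathbb{R}$ with support in $[i_0+r,i_1]$.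 For $k,l\in\mathbb{Z}$ put $(\tau_{k,l}x)_i=x_{i-k}+l$; $x$ is Birkhoff if the collection $\{\tau_{k,l}x: k,l\in\mathbb{Z}\}$ is totally ordered by the pointwise order $x\le y\iff x_i\le y_i$ for all $i\in\mathbb{Z}$. Every Birkhoff $x$ has a unique rotation number $\omega(x)\in\mathbb{R}$, characterized by $|x_i-x_0-\omega(x)\, i|\le1$ for all $i\in\mathbb{Z}$. For $\omega\in\mathbb{R}$, $\mathcal{M}_\omega$ is the set of all Birkhoff global minimizers (for $S$) of rotation number $\omega$, and $\mathcal{M}^\delta_\omega$ is the set defined in the same way with $S^\delta$ in place of $S$. Such a set is called a foliation if for every $\xi\in\mathbb{R}$ it contains an element $x$ with $x_0=\xi$. For $K>0$, $\mathbb{X}_K=\{x:\mathbb{Z}\to\mathbb{R} : |x_{i+1}-x_i|\le K\text{ for all }i\in\mathbb{Z}\}$. $\|f\|_{C^0(\mathbb{X}_K)}$ is the supremum of $|f(x_0,\dots,x_r)|$ over $x\in\mathbb{X}_K$, and $\|f\|_{C^1(\mathbb{X}_K)}$ is the maximum of the suprema over $x\in\mathbb{X}_K$ of $|f(x_0,\dots,x_r)|$ and $|\partial_k f(x_0,\dots,x_r)|$, $0\le k\le r$. *)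

theory Defs
  imports "HOL-Analysis.Analysis"
begin

text \<open>
  A function on \<open>\<real>\<^sup>r\<^sup>+\<^sup>1\<close> is represented by a function of real sequences
  \<open>x 0, x 1, \<dots>\<close> that depends only on \<open>x 0, \<dots>, x r\<close>.  For such functions, continuity
  with respect to the product topology on \<^typ>\<open>nat \<Rightarrow> real\<close> is the same as continuity
  on \<open>\<real>\<^sup>r\<^sup>+\<^sup>1\<close>.
\<close>

definition local_potential :: "nat \<Rightarrow> ((nat \<Rightarrow> real) \<Rightarrow> real) \<Rightarrow> bool" where
  "local_potential r S \<longleftrightarrow> (\<forall>x y. (\<forall>i\<le>r. x i = y i) \<longrightarrow> S x = S y)"

definition partial :: "nat \<Rightarrow> ((nat \<Rightarrow> real) \<Rightarrow> real) \<Rightarrow> (nat \<Rightarrow> real) \<Rightarrow> real" where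
  "partial i f x = deriv (\<lambda>t. f (x(i := t))) (x i)"

definition C1_function :: "nat \<Rightarrow> ((nat \<Rightarrow> real) \<Rightarrow> real) \<Rightarrow> bool" where
  "C1_function r f \<longleftrightarrow>
     (\<forall>i\<le>r. (\<forall>x. (\<lambda>t. f (x(i := t))) field_differentiable at (x i)) \<and>
            continuous_on UNIV (partial i f))"

definition C2_function :: "nat \<Rightarrow> ((nat \<Rightarrow> real) \<Rightarrow> real) \<Rightarrow> bool" where
  "C2_function r f \<longleftrightarrow> C1_function r f \<and> (\<forall>i\<le>r. C1_function r (partial i f))"

definition periodic_potential :: "((nat \<Rightarrow> real) \<Rightarrow> real) \<Rightarrow> bool" where
  "periodic_potential S \<longleftrightarrow> (\<forall>x. S (\<lambda>i. x i + 1) = S x)"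

definition monotone_potential :: "nat \<Rightarrow> ((nat \<Rightarrow> real) \<Rightarrow> real) \<Rightarrow> bool" where
  "monotone_potential r S \<longleftrightarrow>
     C2_function r S \<and>
     (\<forall>i\<le>r. \<forall>k\<le>r. i \<noteq> k \<longrightarrow> (\<forall>x. partial i (partial k S) x \<le> 0)) \<and>
     (\<forall>x. partial 0 (partial 1 S) x < 0)"

text \<open>The limit in the coercivity condition is uniform in the remaining variables.\<close>

definition coercive_potential :: "nat \<Rightarrow> ((nat \<Rightarrow> real) \<Rightarrow> real) \<Rightarrow> bool" where
  "coercive_potential r S \<longleftrightarrow>
     bdd_below (range S) \<and>
     (\<exists>k<r. filterlim S at_top (filtercomap (\<lambda>x. \<bar>x (k + 1) - x k\<bar>) at_top))"

definition window :: "(int \<Rightarrow> real) \<Rightarrow> int \<Rightarrow> nat \<Rightarrow> real" where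
  "window x j = (\<lambda>i. x (j + int i))"

definition action :: "((nat \<Rightarrow> real) \<Rightarrow> real) \<Rightarrow> int \<Rightarrow> int \<Rightarrow> (int \<Rightarrow> real) \<Rightarrow> real" where
  "action S i0 i1 x = (\<Sum>j\<in>{i0..i1}. S (window x j))"

definition global_minimizer :: "nat \<Rightarrow> ((nat \<Rightarrow> real) \<Rightarrow> real) \<Rightarrow> (int \<Rightarrow> real) \<Rightarrow> bool" where
  "global_minimizer r S x \<longleftrightarrow>
     (\<forall>i0 i1 v. i0 \<le> i1 \<longrightarrow> {i. v i \<noteq> 0} \<subseteq> {i0 + int r..i1} \<longrightarrow>
        action S i0 i1 x \<le> action S i0 i1 (\<lambda>i. x i + v i))"

definition translate :: "int \<Rightarrow> int \<Rightarrow> (int \<Rightarrow> real) \<Rightarrow> int \<Rightarrow> real" where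
  "translate k l x = (\<lambda>i. x (i - k) + of_int l)"

definition Birkhoff :: "(int \<Rightarrow> real) \<Rightarrow> bool" where
  "Birkhoff x \<longleftrightarrow>
     (\<forall>y\<in>{translate k l x |k l. True}. \<forall>z\<in>{translate k l x |k l. True}. y \<le> z \<or> z \<le> y)"

definition has_rotation_number :: "(int \<Rightarrow> real) \<Rightarrow> real \<Rightarrow> bool" where
  "has_rotation_number x \<omega> \<longleftrightarrow> (\<forall>i. \<bar>x i - x 0 - \<omega> * of_int i\<bar> \<le> 1)"

definition Birkhoff_minimizers ::
    "nat \<Rightarrow> ((nat \<Rightarrow> real) \<Rightarrow> real) \<Rightarrow> real \<Rightarrow> (int \<Rightarrow> real) set" where
  "Birkhoff_minimizers r S \<omega> =
     {x. Birkhoff x \<and> global_minimizer r S x \<and> has_rotation_number x \<omega>}"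

definition is_foliation :: "(int \<Rightarrow> real) set \<Rightarrow> bool" where
  "is_foliation M \<longleftrightarrow> (\<forall>\<xi>. \<exists>x\<in>M. x 0 = \<xi>)"

definition Lipschitz_sequences :: "real \<Rightarrow> (int \<Rightarrow> real) set" where
  "Lipschitz_sequences K = {x. \<forall>i. \<bar>x (i + 1) - x i\<bar> \<le> K}"

text \<open>
  The suprema are taken in \<^typ>\<open>ereal\<close>, since the supremum of an unbounded set of reals
  is an unspecified value in \<^typ>\<open>real\<close>.
\<close>

definition C0_norm :: "real \<Rightarrow> ((nat \<Rightarrow> real) \<Rightarrow> real) \<Rightarrow> ereal" where
  "C0_norm K f = (SUP x\<in>Lipschitz_sequences K. ereal \<bar>f (window x 0)\<bar>)"

definition C1_norm :: "nat \<Rightarrow> real \<Rightarrow> ((nat \<Rightarrow> real) \<Rightarrow> real) \<Rightarrow> ereal" where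
  "C1_norm r K f = max (C0_norm K f) (MAX k\<in>{..r}. C0_norm K (partial k f))"

end

theory Submission imports Defs begin

text \<open>
  If nearby potentials all had a minimizer through the point \<open>\<xi>\<close> that is missed by the
  minimizers of \<open>S\<close>, compactness of the sequences with rotation number \<open>\<omega>\<close> would give a limit
  \<open>x\<close> which minimizes the action of \<open>S\<close> against all variations \<open>v\<close> with \<open>\<bar>v\<bar> \<le> 1\<close>; these do not
  leave \<open>\<X>\<^sub>K\<close> for \<open>K = \<bar>\<omega>\<bar> + 4\<close>.  The action is submodular by monotonicity and
  invariant under \<open>x \<mapsto> x + 1\<close>.  So an arbitrary variation of \<open>x\<close> can be truncated at the levels
  \<open>x + M, x + M - 1, \<dots>\<close> without increasing the action, since each time only a variation of
  height at most one is cut off.  Hence \<open>x\<close> is a global minimizer.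
\<close>

section \<open>Local potentials\<close>

text \<open>Interpolates from \<open>q\<close> to \<open>p\<close> one coordinate at a time. A local
  potential cannot tell \<open>hybrid (Suc r) p q\<close> from \<open>p\<close>, so finitely many
  one-variable steps suffice.\<close>

definition hybrid :: "nat \<Rightarrow> (nat \<Rightarrow> real) \<Rightarrow> (nat \<Rightarrow> real) \<Rightarrow> nat \<Rightarrow> real" where
  "hybrid j p q = (\<lambda>i. if i < j then p i else q i)"

lemma hybrid_0 [simp]: "hybrid 0 p q = q"
  by (simp add: hybrid_def)

lemma hybrid_Suc: "hybrid (Suc j) p q = (hybrid j p q)(j := p j)"
  by (auto simp: hybrid_def)

lemma local_hybrid:
  assumes "local_potential r S"
  shows "S (hybrid (Suc r) p q) = S p"
  using assms unfolding local_potential_def hybrid_def by (auto simp: less_Suc_eq_le)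

lemma local_partial:
  assumes "local_potential r S" "k \<le> r"
  shows "local_potential r (partial k S)"
  unfolding local_potential_def
proof (intro allI impI)
  fix x y :: "nat \<Rightarrow> real"
  assume eq: "\<forall>i\<le>r. x i = y i"
  have "S (x(k := t)) = S (y(k := t))" for t
    using assms(1) eq unfolding local_potential_def by (metis fun_upd_apply)
  then show "partial k S x = partial k S y"
    using eq assms(2) by (simp add: partial_def)
qed

lemma DERIV_partial:
  assumes "C1_function r f" "k \<le> r"
  shows "((\<lambda>t. f (x(k := t))) has_real_derivative partial k f (x(k := t))) (at t)"
proof -
  have "(\<lambda>s. f ((x(k := t))(k := s))) field_differentiable at ((x(k := t)) k)"
    using assms unfolding C1_function_def by blast
  then have "(\<lambda>s. f (x(k := s))) field_differentiable at t"
    by simp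
  then show ?thesis
    by (simp add: partial_def DERIV_deriv_iff_field_differentiable)
qed

section \<open>Continuity of potentials with continuous partial derivatives\<close>

lemma continuous_on_hybrid_upd:
  "continuous_on UNIV (\<lambda>(x :: nat \<Rightarrow> real, t :: real). (hybrid j x q)(j := t * x j))"
proof (rule continuous_on_coordinatewise_then_product)
  fix i
  show "continuous_on UNIV
    (\<lambda>p. (case p of (x :: nat \<Rightarrow> real, t :: real) \<Rightarrow> (hybrid j x q)(j := t * x j)) i)"
    by (cases "i < j"; cases "i = j")
       (auto simp: hybrid_def case_prod_beta intro!: continuous_intros
          continuous_on_compose2[OF continuous_on_product_coordinates continuous_on_fst])
qed

text \<open>\<open>C1_function\<close> demands continuity of the partial derivatives only. Switching
  on the coordinates of \<open>x\<close> one by one, starting from zero, changes \<open>S\<close> by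
  integrals that depend continuously on \<open>x\<close>.\<close>

lemma continuous_on_potential:
  assumes "local_potential r S" "C1_function r S"
  shows "continuous_on UNIV S"
proof -
  have "continuous_on UNIV (\<lambda>x. S (hybrid j x (\<lambda>_. 0)))" if "j \<le> Suc r" for j
    using that
  proof (induction j)
    case 0
    then show ?case by simp
  next
    case (Suc j)
    then have j: "j \<le> r" by simp
    \<comment> \<open>Moving along \<open>t * x j\<close> with \<open>t\<close> in
      \<open>{0..1}\<close> keeps the domain of integration independent of \<open>x\<close>.\<close>
    let ?h = "\<lambda>x t. (hybrid j x (\<lambda>_. 0))(j := t * x j)"
    have int: "((\<lambda>t. x j * partial j S (?h x t)) has_integral
        S (hybrid (Suc j) x (\<lambda>_. 0)) - S (hybrid j x (\<lambda>_. 0))) {0..1}" for x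
    proof -
      have "((\<lambda>t. S (?h x t)) has_real_derivative x j * partial j S (?h x t)) (at t)" for t
        using DERIV_chain2[OF DERIV_partial[OF assms(2) j, of "hybrid j x (\<lambda>_. 0)"]
            DERIV_cmult_right[OF DERIV_ident, of "x j"], of t]
        by (simp add: mult.commute)
      then have "((\<lambda>t. x j * partial j S (?h x t)) has_integral S (?h x 1) - S (?h x 0)) {0..1}"
        by (intro fundamental_theorem_of_calculus)
           (simp_all add: has_real_derivative_iff_has_vector_derivative[symmetric]
              has_field_derivative_at_within del: fun_upd_apply)
      moreover have "?h x 0 = hybrid j x (\<lambda>_. 0)"
        by (auto simp: hybrid_def)
      ultimately show ?thesis by (simp add: hybrid_Suc)
    qed
    have "continuous_on UNIV (partial j S)"
      using assms(2) j unfolding C1_function_def by blast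
    then have "continuous_on UNIV (\<lambda>p :: (nat \<Rightarrow> real) \<times> real. partial j S (?h (fst p) (snd p)))"
      using continuous_on_compose2 continuous_on_hybrid_upd[unfolded case_prod_beta] by blast
    moreover have "continuous_on UNIV (\<lambda>p :: (nat \<Rightarrow> real) \<times> real. fst p j)"
      by (intro continuous_on_compose2[OF continuous_on_product_coordinates continuous_on_fst])
         (auto intro: continuous_intros)
    ultimately have "continuous_on UNIV
        (\<lambda>p :: (nat \<Rightarrow> real) \<times> real. fst p j * partial j S (?h (fst p) (snd p)))"
      by (intro continuous_on_mult)
    then have "continuous_on (UNIV \<times> cbox 0 1)
        (\<lambda>(x :: nat \<Rightarrow> real, t :: real). x j * partial j S (?h x t))"
      unfolding case_prod_beta by (rule continuous_on_subset) simp
    then have "continuous_on UNIV (\<lambda>x. integral (cbox 0 1) (\<lambda>t. x j * partial j S (?h x t)))"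
      by (rule integral_continuous_on_param)
    then have "continuous_on UNIV
        (\<lambda>x. S (hybrid (Suc j) x (\<lambda>_. 0)) - S (hybrid j x (\<lambda>_. 0)))"
      using integral_unique[OF int] by simp
    from continuous_on_add[OF this Suc.IH] j show ?case by simp
  qed
  from this[of "Suc r"] show ?thesis
    by (simp add: local_hybrid[OF assms(1)])
qed

text \<open>Going from \<open>x\<close> to \<open>y\<close> moves only coordinates other than
  \<open>k\<close>, and there the mixed second derivatives are nonpositive. The pure second
  derivative, whose sign is unknown, is avoided by \<open>x k = y k\<close>.\<close>

lemma partial_antimono:
  assumes "local_potential r S" "monotone_potential r S" "k \<le> r" "x \<le> y" "x k = y k"
  shows "partial k S y \<le> partial k S x"
proof -
  have C1: "C1_function r (partial k S)"
    using assms(2,3) unfolding monotone_potential_def C2_function_def by blast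
  have "partial k S (hybrid j y x) \<le> partial k S x" if "j \<le> Suc r" for j
    using that
  proof (induction j)
    case 0
    then show ?case by simp
  next
    case (Suc j)
    have "partial k S ((hybrid j y x)(j := y j)) \<le> partial k S ((hybrid j y x)(j := x j))"
    proof (cases "j = k")
      case True
      then show ?thesis using assms(5) by simp
    next
      case False
      then have "partial j (partial k S) z \<le> 0" for z
        using assms(2,3) Suc.prems unfolding monotone_potential_def by auto
      moreover have "j \<le> r" "x j \<le> y j"
        using Suc.prems assms(4) by (auto simp: le_fun_def)
      ultimately show ?thesis
        using DERIV_partial[OF C1]
        by (intro DERIV_nonpos_imp_nonincreasing
            [where f = "\<lambda>t. partial k S ((hybrid j y x)(j := t))"]) blast+
    qed
    moreover have "(hybrid j y x)(j := x j) = hybrid j y x"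
      by (auto simp: hybrid_def)
    ultimately show ?case
      using Suc by (simp add: hybrid_Suc del: fun_upd_apply)
  qed
  from this[of "Suc r"] show ?thesis
    by (simp add: local_hybrid[OF local_partial[OF assms(1,3)]])
qed

text \<open>By \<open>partial_antimono\<close> the difference of \<open>S\<close> along the two
  parallel segments in direction \<open>k\<close> has a nonpositive derivative. In other words,
  \<open>- S\<close> has increasing differences.\<close>

lemma increasing_differences:
  assumes "local_potential r S" "monotone_potential r S" "k \<le> r" "x \<le> y" "x k = y k" "y k \<le> c"
  shows "S (y(k := c)) - S y \<le> S (x(k := c)) - S x"
proof -
  have C1: "C1_function r S"
    using assms(2) unfolding monotone_potential_def C2_function_def by blast
  have "partial k S (y(k := t)) - partial k S (x(k := t)) \<le> 0" for t
    using partial_antimono[OF assms(1-3), of "x(k := t)" "y(k := t)"] assms(4)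
    by (simp add: le_fun_def)
  then have "S (y(k := c)) - S (x(k := c)) \<le> S (y(k := y k)) - S (x(k := y k))"
    using DERIV_diff[OF DERIV_partial[OF C1 assms(3), of y] DERIV_partial[OF C1 assms(3), of x]]
    by (intro DERIV_nonpos_imp_nonincreasing[OF assms(6)]) blast
  moreover have "x(k := y k) = x"
    using assms(5) by (auto simp: fun_eq_iff)
  ultimately show ?thesis by simp
qed

text \<open>Raise \<open>y\<close> to the maximum and, in parallel, the minimum to \<open>z\<close>.
  Both paths move the same coordinates by the same amounts, and the first stays above the second, so
  each step raises \<open>S\<close> by no more on the first path than on the second.\<close>

lemma submodular_potential:
  assumes "local_potential r S" "monotone_potential r S"
  shows "S (\<lambda>i. max (y i) (z i)) + S (\<lambda>i. min (y i) (z i)) \<le> S y + S z"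
proof -
  define p where "p = (\<lambda>i. max (y i) (z i))"
  define m where "m = (\<lambda>i. min (y i) (z i))"
  have "S (hybrid j p y) - S y \<le> S (hybrid j z m) - S m" if "j \<le> Suc r" for j
    using that
  proof (induction j)
    case 0
    then show ?case by simp
  next
    case (Suc j)
    have "S (hybrid (Suc j) p y) - S (hybrid j p y) \<le> S (hybrid (Suc j) z m) - S (hybrid j z m)"
    proof (cases "y j \<le> z j")
      case True
      have "S ((hybrid j p y)(j := z j)) - S (hybrid j p y)
          \<le> S ((hybrid j z m)(j := z j)) - S (hybrid j z m)"
        using True Suc.prems by (intro increasing_differences[OF assms])
          (auto simp: hybrid_def p_def m_def le_fun_def)
      moreover have "p j = z j"
        using True by (simp add: p_def)
      ultimately show ?thesis
        by (simp only: hybrid_Suc)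
    next
      case False
      \<comment> \<open>Here \<open>p j = y j\<close> and \<open>m j = z j\<close>, so neither path
        moves.\<close>
      then have "hybrid (Suc j) p y = hybrid j p y" "hybrid (Suc j) z m = hybrid j z m"
        by (auto simp: hybrid_def p_def m_def less_Suc_eq)
      then show ?thesis by simp
    qed
    then show ?case using Suc by simp
  qed
  from this[of "Suc r"] show ?thesis
    by (simp add: local_hybrid[OF assms(1)] p_def m_def)
qed

section \<open>The action\<close>

lemma submodular_action:
  assumes "local_potential r S" "monotone_potential r S"
  shows "action S a b (\<lambda>i. max (y i) (z i)) + action S a b (\<lambda>i. min (y i) (z i))
    \<le> action S a b y + action S a b z"
  unfolding action_def sum.distrib[symmetric] window_def
  by (intro sum_mono submodular_potential[OF assms])

lemma action_shift:
  assumes "periodic_potential S"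
  shows "action S a b (\<lambda>i. x i + of_nat m) = action S a b x"
proof -
  have "S (\<lambda>i. w i + of_nat m) = S w" for w
  proof (induction m)
    case (Suc m)
    have "S (\<lambda>i. (w i + of_nat m) + 1) = S (\<lambda>i. w i + of_nat m)"
      using assms unfolding periodic_potential_def by (rule spec)
    with Suc show ?case by (simp add: algebra_simps)
  qed simp
  then show ?thesis by (simp add: action_def window_def)
qed

lemma continuous_on_action:
  assumes "continuous_on UNIV S"
  shows "continuous_on UNIV (\<lambda>x. action S a b (\<lambda>i. x i + v i))"
  unfolding action_def
proof (intro continuous_on_sum continuous_on_compose2[OF assms])
  fix j
  show "continuous_on UNIV (\<lambda>x. window (\<lambda>i. x i + v i) j)"
    unfolding window_def
    by (intro continuous_on_coordinatewise_then_product continuous_on_add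
        continuous_on_product_coordinates continuous_on_const)
qed auto

text \<open>Cut \<open>x + v\<close> at the level \<open>x + M\<close>. The part above is a unit
  variation of \<open>x + M\<close>, which has the same action as \<open>x\<close>; the part below
  has height at most \<open>M\<close>. Neither has less action than \<open>x\<close>, and
  submodularity adds up the two bounds.\<close>

lemma unit_minimal_imp_minimal_pos:
  assumes S: "local_potential r S" "monotone_potential r S" "periodic_potential S"
    and min: "\<And>v. {i. v i \<noteq> 0} \<subseteq> I \<Longrightarrow> (\<And>i. \<bar>v i\<bar> \<le> 1) \<Longrightarrow>
      action S a b x \<le> action S a b (\<lambda>i. x i + v i)"
    and v: "{i. v i \<noteq> 0} \<subseteq> I" "\<And>i. 0 \<le> v i" "\<And>i. v i \<le> real M"
  shows "action S a b x \<le> action S a b (\<lambda>i. x i + v i)"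
  using v
proof (induction M arbitrary: v)
  case 0
  then have "v i = 0" for i using "0.prems"(2,3)[of i] by (simp add: order_antisym)
  then show ?case by simp
next
  case (Suc M)
  \<comment> \<open>The part of \<open>v\<close> above height \<open>M\<close>: at most one, and
    supported where \<open>v\<close> is.\<close>
  define u where "u = (\<lambda>i. max (v i - real M) 0)"
  have "action S a b x \<le> action S a b (\<lambda>i. x i + u i)"
  proof (rule min)
    show "{i. u i \<noteq> 0} \<subseteq> I"
      using Suc.prems(1) by (auto simp: u_def max_def split: if_splits)
    show "\<bar>u i\<bar> \<le> 1" for i
      using Suc.prems(3)[of i] by (auto simp: u_def)
  qed
  also have "\<dots> = action S a b (\<lambda>i. max (x i + v i) (x i + real M))"
    by (subst action_shift[OF S(3), symmetric, of _ _ _ M])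
       (rule arg_cong[of _ _ "action S a b"], auto simp: u_def)
  finally have "action S a b x \<le> action S a b (\<lambda>i. max (x i + v i) (x i + real M))" .
  moreover have "action S a b x \<le> action S a b (\<lambda>i. x i + min (v i) (real M))"
    using Suc.prems by (intro Suc.IH) (auto simp: min_def split: if_splits)
  then have "action S a b x \<le> action S a b (\<lambda>i. min (x i + v i) (x i + real M))"
    by (simp add: min_add_distrib_right)
  ultimately show ?case
    using submodular_action[OF S(1,2), of a b "\<lambda>i. x i + v i" "\<lambda>i. x i + real M"]
      action_shift[OF S(3), of a b x M] by simp
qed

text \<open>Mirror image, cutting at \<open>x - M\<close>. Since \<open>action_shift\<close> adds
  natural numbers only, the cut-off part is raised by \<open>M\<close> to become a unit variation of
  \<open>x\<close>.\<close>

lemma unit_minimal_imp_minimal_neg: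
  assumes S: "local_potential r S" "monotone_potential r S" "periodic_potential S"
    and min: "\<And>v. {i. v i \<noteq> 0} \<subseteq> I \<Longrightarrow> (\<And>i. \<bar>v i\<bar> \<le> 1) \<Longrightarrow>
      action S a b x \<le> action S a b (\<lambda>i. x i + v i)"
    and v: "{i. v i \<noteq> 0} \<subseteq> I" "\<And>i. v i \<le> 0" "\<And>i. - real M \<le> v i"
  shows "action S a b x \<le> action S a b (\<lambda>i. x i + v i)"
  using v
proof (induction M arbitrary: v)
  case 0
  then have "v i = 0" for i using "0.prems"(2,3)[of i] by (simp add: order_antisym)
  then show ?case by simp
next
  case (Suc M)
  have v0: "v i = 0" if "i \<notin> I" for i
    using Suc.prems(1) that by blast
  define u where "u = (\<lambda>i. min (v i + real M) 0)"
  have "action S a b x \<le> action S a b (\<lambda>i. x i + u i)"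
  proof (rule min)
    show "{i. u i \<noteq> 0} \<subseteq> I"
      using Suc.prems(1) by (auto simp: u_def min_def split: if_splits)
    show "\<bar>u i\<bar> \<le> 1" for i
      using Suc.prems(3)[of i] by (auto simp: u_def)
  qed
  also have "(\<lambda>i. x i + u i) = (\<lambda>i. min (x i + v i) (x i - real M) + real M)"
    by (auto simp: u_def)
  finally have "action S a b x \<le> action S a b (\<lambda>i. min (x i + v i) (x i - real M))"
    by (simp add: action_shift[OF S(3)])
  moreover have "action S a b x \<le> action S a b (\<lambda>i. x i + max (v i) (- real M))"
    using Suc.prems(2,3) v0 by (intro Suc.IH) (auto simp: max_def split: if_splits)
  then have "action S a b x \<le> action S a b (\<lambda>i. max (x i + v i) (x i - real M))"
    by (simp add: max_add_distrib_right)
  ultimately show ?case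
    using submodular_action[OF S(1,2), of a b "\<lambda>i. x i + v i" "\<lambda>i. x i - real M"]
      action_shift[OF S(3), of a b "\<lambda>i. x i - real M" M] by simp
qed

text \<open>One more cut, at the level of \<open>x\<close> itself, splits \<open>v\<close> into its
  positive and negative parts; finite support bounds their heights.\<close>

lemma unit_minimal_imp_minimal:
  assumes S: "local_potential r S" "monotone_potential r S" "periodic_potential S"
    and min: "\<And>v. {i. v i \<noteq> 0} \<subseteq> I \<Longrightarrow> (\<And>i. \<bar>v i\<bar> \<le> 1) \<Longrightarrow>
      action S a b x \<le> action S a b (\<lambda>i. x i + v i)"
    and v: "{i. v i \<noteq> 0} \<subseteq> I" "finite I"
  shows "action S a b x \<le> action S a b (\<lambda>i. x i + v i)"
proof -
  obtain M :: nat where "(\<Sum>i\<in>I. \<bar>v i\<bar>) \<le> real M"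
    using real_arch_simple by blast
  moreover have "\<bar>v i\<bar> \<le> (\<Sum>i\<in>I. \<bar>v i\<bar>)" for i
  proof (cases "i \<in> I")
    case True
    then show ?thesis using v(2) by (intro member_le_sum) auto
  next
    case False
    then have "v i = 0" using v(1) by auto
    then show ?thesis by (simp add: sum_nonneg)
  qed
  ultimately have M: "\<bar>v i\<bar> \<le> real M" for i
    using order_trans by blast
  have vi: "v i \<le> real M" "- real M \<le> v i" for i
    using M[of i] by auto
  have "action S a b x \<le> action S a b (\<lambda>i. x i + max (v i) 0)"
    using v(1) vi by (intro unit_minimal_imp_minimal_pos[where M = M, OF S min])
      (auto simp: max_def split: if_splits)
  moreover have "action S a b x \<le> action S a b (\<lambda>i. x i + min (v i) 0)"
    using v(1) vi by (intro unit_minimal_imp_minimal_neg[where M = M, OF S min])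
      (auto simp: min_def split: if_splits)
  ultimately show ?thesis
    using submodular_action[OF S(1,2), of a b "\<lambda>i. x i + v i" x]
    by (simp add: max_add_distrib_right min_add_distrib_right)
qed

section \<open>Approximate minimizers\<close>

text \<open>The slack allows an error of \<open>\<delta>\<close> per summand in each of the two
  actions compared. For \<open>a > b\<close> the condition is trivial, as all sums are
  empty.\<close>

definition approx_minimizers ::
    "nat \<Rightarrow> ((nat \<Rightarrow> real) \<Rightarrow> real) \<Rightarrow> real \<Rightarrow> real \<Rightarrow> real \<Rightarrow> (int \<Rightarrow> real) set" where
  "approx_minimizers r S \<omega> \<xi> \<delta> =
     {x. Birkhoff x \<and> has_rotation_number x \<omega> \<and> x 0 = \<xi> \<and>
       (\<forall>a b v. {i. v i \<noteq> 0} \<subseteq> {a + int r..b} \<longrightarrow> (\<forall>i. \<bar>v i\<bar> \<le> 1) \<longrightarrow>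
          action S a b x \<le> action S a b (\<lambda>i. x i + v i) + 2 * \<delta> * card {a..b})}"

text \<open>Comparability of two given translates is a union of two sets, each cut out by weak
  inequalities between coordinates, hence closed in the product topology.\<close>

lemma closed_Birkhoff: "closed {x. Birkhoff x}"
proof -
  have "{x. Birkhoff x} = {x. \<forall>k l k' l'. (\<forall>i. translate k l x i \<le> translate k' l' x i) \<or>
      (\<forall>i. translate k' l' x i \<le> translate k l x i)}"
    unfolding Birkhoff_def le_fun_def by blast
  also have "closed \<dots>"
    unfolding translate_def
    by (intro closed_Collect_all closed_Collect_disj closed_Collect_le continuous_intros
        continuous_on_product_coordinates)
  finally show ?thesis .
qed

lemma closed_approx_minimizers:
  assumes "continuous_on UNIV S"
  shows "closed (approx_minimizers r S \<omega> \<xi> \<delta>)"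
proof -
  have cont: "continuous_on UNIV (\<lambda>x. action S a b x)" for a b
    using continuous_on_action[OF assms, of a b "\<lambda>_. 0"] by simp
  \<comment> \<open>The premises on \<open>v\<close> do not involve \<open>x\<close>, so each
    implication is either vacuous or its conclusion.\<close>
  have imp: "closed {x :: int \<Rightarrow> real. P \<longrightarrow> Q x}" if "closed {x. Q x}" for P Q
    using that by (cases P) auto
  show ?thesis
    unfolding approx_minimizers_def has_rotation_number_def
    by (intro closed_Collect_conj closed_Birkhoff closed_Collect_all imp
        closed_Collect_le closed_Collect_eq continuous_on_add continuous_on_diff
        continuous_on_const continuous_on_rabs continuous_on_product_coordinates cont
        continuous_on_action[OF assms])
qed

lemma approx_minimizers_mono:
  assumes "\<delta> \<le> \<delta>'"
  shows "approx_minimizers r S \<omega> \<xi> \<delta> \<subseteq> approx_minimizers r S \<omega> \<xi> \<delta>'"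
proof -
  have "2 * \<delta> * card {a..b} \<le> 2 * \<delta>' * card {a..b}" for a b :: int
    using assms by (intro mult_right_mono) auto
  then show ?thesis
    unfolding approx_minimizers_def by (blast intro: order_trans add_left_mono)
qed

lemma compact_box:
  fixes l u :: "'a \<Rightarrow> real"
  shows "compact {x. \<forall>i. x i \<in> {l i..u i}}"
proof -
  have "compactin (product_topology (\<lambda>i. euclidean) UNIV) (PiE UNIV (\<lambda>i. {l i..u i}))"
    by (subst compactin_PiE) auto
  moreover have "PiE UNIV (\<lambda>i. {l i..u i}) = {x. \<forall>i. x i \<in> {l i..u i}}"
    by (auto simp: PiE_def Pi_def)
  ultimately show ?thesis
    by (simp only: euclidean_product_topology compactin_euclidean_iff)
qed

text \<open>The approximate minimizers form nested nonempty closed subsets of a compact box, so some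
  \<open>x\<close> lies in all of them. On a fixed interval the slack tends to zero, which leaves
  exact minimality against unit variations.\<close>

lemma minimizer_of_approx_minimizers:
  assumes S: "local_potential r S" "monotone_potential r S" "periodic_potential S"
    and ne: "\<And>\<delta>. \<delta> > 0 \<Longrightarrow> approx_minimizers r S \<omega> \<xi> \<delta> \<noteq> {}"
  shows "\<exists>x\<in>Birkhoff_minimizers r S \<omega>. x 0 = \<xi>"
proof -
  define A where "A = (\<lambda>n :: nat. approx_minimizers r S \<omega> \<xi> (1 / (real n + 1)))"
  \<comment> \<open>The rotation number and \<open>x 0 = \<xi>\<close> confine each coordinate to an
    interval of length two.\<close>
  define B where "B = {x. \<forall>i. x i \<in> {\<xi> + \<omega> * of_int i - 1..\<xi> + \<omega> * of_int i + 1}}"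
  have "C1_function r S"
    using S(2) unfolding monotone_potential_def C2_function_def by blast
  then have closed: "closed (A n)" for n
    unfolding A_def by (intro closed_approx_minimizers continuous_on_potential[OF S(1)])
  have AB: "A n \<subseteq> B" for n
  proof
    fix x
    assume "x \<in> A n"
    then have "\<bar>x i - \<xi> - \<omega> * of_int i\<bar> \<le> 1" for i
      unfolding A_def approx_minimizers_def has_rotation_number_def by blast
    then show "x \<in> B"
      unfolding B_def by (simp add: abs_le_iff algebra_simps)
  qed
  have "B \<inter> (\<Inter>n\<in>UNIV. A n) \<noteq> {}"
  proof (rule compact_imp_fip_image)
    show "compact B"
      unfolding B_def by (rule compact_box)
    show "closed (A n)" for n by (rule closed)
    fix N :: "nat set"
    assume fin: "finite N"
    \<comment> \<open>Inserting \<open>0\<close> covers the case of empty \<open>N\<close>.\<close>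
    define m where "m = Max (insert 0 N)"
    have "n \<le> m" if "n \<in> N" for n
      using fin that by (simp add: m_def)
    then have "A m \<subseteq> A n" if "n \<in> N" for n
      unfolding A_def using that by (intro approx_minimizers_mono frac_le) auto
    moreover obtain x where "x \<in> A m"
      using ne[of "1 / (real m + 1)"] unfolding A_def by auto
    ultimately show "B \<inter> (\<Inter>n\<in>N. A n) \<noteq> {}"
      using AB by blast
  qed
  then obtain x where x: "x \<in> A n" for n by blast
  have unit: "action S a b x \<le> action S a b (\<lambda>i. x i + v i)"
    if "{i. v i \<noteq> 0} \<subseteq> {a + int r..b}" "\<And>i. \<bar>v i\<bar> \<le> 1" for a b v
  proof (rule LIMSEQ_le_const)
    have "(\<lambda>n. 1 / (real n + 1)) \<longlonglongrightarrow> 0"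
      using LIMSEQ_inverse_real_of_nat by (simp add: inverse_eq_divide add.commute)
    from tendsto_add[OF tendsto_const tendsto_mult_right[OF tendsto_mult_left[OF this]]]
    show "(\<lambda>n. action S a b (\<lambda>i. x i + v i) + 2 * (1 / (real n + 1)) * card {a..b})
        \<longlonglongrightarrow> action S a b (\<lambda>i. x i + v i)"
      by (rule tendsto_eq_rhs) simp
    have "action S a b x
        \<le> action S a b (\<lambda>i. x i + v i) + 2 * (1 / (real n + 1)) * card {a..b}" for n
      using x[of n] that unfolding A_def approx_minimizers_def by simp
    then show "\<exists>N. \<forall>n\<ge>N. action S a b x
        \<le> action S a b (\<lambda>i. x i + v i) + 2 * (1 / (real n + 1)) * card {a..b}"
      by blast
  qed
  have "global_minimizer r S x"
    unfolding global_minimizer_def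
  proof (intro allI impI)
    fix a b :: int and v :: "int \<Rightarrow> real"
    assume v: "{i. v i \<noteq> 0} \<subseteq> {a + int r..b}"
    show "action S a b x \<le> action S a b (\<lambda>i. x i + v i)"
      using unit by (rule unit_minimal_imp_minimal[OF S _ v]) simp_all
  qed
  moreover have "Birkhoff x" "has_rotation_number x \<omega>" "x 0 = \<xi>"
    using x[of 0] by (simp_all add: A_def approx_minimizers_def)
  ultimately show ?thesis
    unfolding Birkhoff_minimizers_def by blast
qed

section \<open>Comparison of two nearby potentials\<close>

lemma action_close:
  assumes "C0_norm K (\<lambda>x. S' x - S x) < ereal \<delta>" "x \<in> Lipschitz_sequences K"
  shows "\<bar>action S' a b x - action S a b x\<bar> \<le> \<delta> * card {a..b}"
proof -
  have "\<bar>S' (window x j) - S (window x j)\<bar> \<le> \<delta>" for j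
  proof -
    \<comment> \<open>\<open>C0_norm\<close> looks at the window at \<open>0\<close> only; the
      Lipschitz sequences are shift invariant, so any window can be moved there.\<close>
    have "(\<lambda>i. x (j + i)) \<in> Lipschitz_sequences K"
      using assms(2) unfolding Lipschitz_sequences_def
      by (auto simp: add.assoc[symmetric])
    then have "ereal \<bar>S' (window (\<lambda>i. x (j + i)) 0) - S (window (\<lambda>i. x (j + i)) 0)\<bar>
        \<le> C0_norm K (\<lambda>x. S' x - S x)"
      unfolding C0_norm_def by (rule SUP_upper)
    also note assms(1)
    finally show ?thesis by (simp add: window_def)
  qed
  then have "\<bar>\<Sum>j\<in>{a..b}. S' (window x j) - S (window x j)\<bar> \<le> (\<Sum>j\<in>{a..b}. \<delta>)"
    by (intro order_trans[OF sum_abs] sum_mono)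
  then show ?thesis
    by (simp add: action_def sum_subtractf mult.commute)
qed

text \<open>The rotation estimates at \<open>i\<close> and \<open>i + 1\<close> bound the increments
  of \<open>x\<close> by \<open>\<bar>\<omega>\<bar> + 2\<close>, and a unit variation adds at most
  2. So both competitors lie where \<open>S'\<close> is close to \<open>S\<close>.\<close>

lemma minimizer_imp_approx_minimizer:
  assumes close: "C0_norm (\<bar>\<omega>\<bar> + 4) (\<lambda>x. S' x - S x) < ereal \<delta>"
    and x: "x \<in> Birkhoff_minimizers r S' \<omega>"
  shows "x \<in> approx_minimizers r S \<omega> (x 0) \<delta>"
proof -
  have Lip: "(\<lambda>i. x i + v i) \<in> Lipschitz_sequences (\<bar>\<omega>\<bar> + 4)" if "\<And>i. \<bar>v i\<bar> \<le> 1" for v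
    unfolding Lipschitz_sequences_def
  proof (intro CollectI allI)
    fix i
    have rot: "\<bar>x k - x 0 - \<omega> * of_int k\<bar> \<le> 1" for k
      using x unfolding Birkhoff_minimizers_def has_rotation_number_def by blast
    have "\<bar>x (i + 1) - x 0 - (\<omega> * of_int i + \<omega>)\<bar> \<le> 1"
      using rot[of "i + 1"] by (simp add: distrib_left)
    then show "\<bar>x (i + 1) + v (i + 1) - (x i + v i)\<bar> \<le> \<bar>\<omega>\<bar> + 4"
      using rot[of i] that[of i] that[of "i + 1"] by linarith
  qed
  have "action S a b x \<le> action S a b (\<lambda>i. x i + v i) + 2 * \<delta> * card {a..b}"
    if v: "{i. v i \<noteq> 0} \<subseteq> {a + int r..b}" "\<forall>i. \<bar>v i\<bar> \<le> 1" for a b v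
  proof (cases "a \<le> b")
    case True
    then have "action S' a b x \<le> action S' a b (\<lambda>i. x i + v i)"
      using x v(1) unfolding Birkhoff_minimizers_def global_minimizer_def by blast
    moreover have "\<bar>action S' a b x - action S a b x\<bar> \<le> \<delta> * card {a..b}"
      using action_close[OF close Lip[of "\<lambda>_. 0"]] by simp
    moreover have "\<bar>action S' a b (\<lambda>i. x i + v i) - action S a b (\<lambda>i. x i + v i)\<bar>
        \<le> \<delta> * card {a..b}"
      using action_close[OF close Lip] v(2) by blast
    ultimately show ?thesis by linarith
  next
    case False
    \<comment> \<open>\<open>global_minimizer\<close> says nothing about empty intervals, but there
      both actions and the slack vanish.\<close>
    then show ?thesis by (simp add: action_def)
  qed
  then show ?thesis
    using x unfolding approx_minimizers_def Birkhoff_minimizers_def by auto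
qed

theorem theorem6p2:
  fixes r :: nat and \<omega> :: real and S :: "(nat \<Rightarrow> real) \<Rightarrow> real"
  assumes "r \<ge> 1"
    and "local_potential r S"
    and "periodic_potential S" and "monotone_potential r S" and "coercive_potential r S"
    and "\<not> is_foliation (Birkhoff_minimizers r S \<omega>)"
  shows "\<exists>\<delta>>0. \<exists>K>0. \<forall>S' :: (nat \<Rightarrow> real) \<Rightarrow> real.
           local_potential r S' \<longrightarrow>
           periodic_potential S' \<longrightarrow> monotone_potential r S' \<longrightarrow> coercive_potential r S' \<longrightarrow>
           C0_norm K (\<lambda>x. S' x - S x) < ereal \<delta> \<longrightarrow>
           C1_norm r K (\<lambda>x. S' x - S x) \<le> 1 \<longrightarrow>
           \<not> is_foliation (Birkhoff_minimizers r S' \<omega>)"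
proof -
  from assms(6) obtain \<xi> where "\<not> (\<exists>x\<in>Birkhoff_minimizers r S \<omega>. x 0 = \<xi>)"
    unfolding is_foliation_def by blast
  \<comment> \<open>Contrapositive of the limit argument: as no minimizer of \<open>S\<close> passes
    through \<open>\<xi>\<close>, some slack admits no approximate minimizer there. A foliation for
    \<open>S'\<close> would supply one.\<close>
  then obtain \<delta> where \<delta>: "\<delta> > 0" "approx_minimizers r S \<omega> \<xi> \<delta> = {}"
    using minimizer_of_approx_minimizers[OF assms(2,4,3)] by blast
  have "\<not> is_foliation (Birkhoff_minimizers r S' \<omega>)"
    if "C0_norm (\<bar>\<omega>\<bar> + 4) (\<lambda>x. S' x - S x) < ereal \<delta>" for S'
    using minimizer_imp_approx_minimizer[OF that, of _ r] \<delta>(2) unfolding is_foliation_def by (metis empty_iff)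
  moreover have "\<bar>\<omega>\<bar> + 4 > 0" by simp
  ultimately show ?thesis
    using \<delta>(1) by blast
qed

end
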